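(* Let $0\le\epsilon<1$. If there exists a family of connected graphs $\{G_n\}_{n\in I}$ with $c(G_n)=\Theta(n^{1-\epsilon})$ and $|V(G_n)|=\Theta(n)$, then there exists a family of bipartite connected graphs $\{G_n'\}_{n\in I}$ with $c(G_n')=\Theta(n^{1-\epsilon})$ and $|V(G_n')|=\Theta(n)$.
   Context: All graphs are finite, simple and undirected; $I$ is an infinite set of positive integers used as an index set (here $n$ need not be exactly the order of $G_n$). Cops and Robbers on a graph $G$: in round $0$ the cops choose vertices to occupy, then the robber chooses a vertex. In each later round the cops move first and then the robber. On a move, each player moves to a neighboring vertex or stays put; any subset of the cops may move. Both sides have complete information. The cops win if after finitely many rounds some cop occupies the robber's vertex; otherwise the robber wins. The cop number $c(G)$ is the minimum number of cops that guarantees a win for the cops. *)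

theory Defs
  imports "HOL-Library.Landau_Symbols" "Graph_Theory.Graph_Theory"
begin

text \<open>
  Finite simple undirected graphs are rendered by the locale predicate \<^const>\<open>pair_graph\<close>:
  a finite vertex set together with a symmetric, irreflexive arc relation on it.
\<close>

definition bipartite :: "'a pair_pre_digraph \<Rightarrow> bool" where
  "bipartite G \<longleftrightarrow> (\<exists>A B. A \<union> B = pverts G \<and> A \<inter> B = {} \<and> parcs G \<subseteq> A \<times> B \<union> B \<times> A)"

definition legal_move :: "'a pair_pre_digraph \<Rightarrow> 'a \<Rightarrow> 'a \<Rightarrow> bool" where
  "legal_move G u v \<longleftrightarrow> u \<in> pverts G \<and> v \<in> pverts G \<and> (u = v \<or> (u, v) \<in> parcs G)"

text \<open>
  The positions of \<open>k\<close> cops form a list of length \<open>k\<close> (several cops may share a vertex).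
  A strategy maps the list of all robber positions so far to the positions the cops take next:
  \<open>\<sigma> []\<close> is the initial placement, and \<open>\<sigma> [r\<^sub>0, \<dots>, r\<^sub>t]\<close> is the placement after the cops' move
  in round \<open>t + 1\<close>. The cops' own earlier positions are determined by \<open>\<sigma>\<close> and the robber's
  positions, so this is complete information. A robber play is an infinite sequence of positions;
  what happens after a capture is irrelevant.
\<close>

definition robber_play :: "'a pair_pre_digraph \<Rightarrow> (nat \<Rightarrow> 'a) \<Rightarrow> bool" where
  "robber_play G r \<longleftrightarrow> r 0 \<in> pverts G \<and> (\<forall>t. legal_move G (r t) (r (Suc t)))"

definition cop_positions :: "('a list \<Rightarrow> 'a list) \<Rightarrow> (nat \<Rightarrow> 'a) \<Rightarrow> nat \<Rightarrow> 'a list" where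
  "cop_positions \<sigma> r t = \<sigma> (map r [0..<t])"

definition cop_strategy :: "'a pair_pre_digraph \<Rightarrow> nat \<Rightarrow> ('a list \<Rightarrow> 'a list) \<Rightarrow> bool" where
  "cop_strategy G k \<sigma> \<longleftrightarrow>
     length (\<sigma> []) = k \<and> set (\<sigma> []) \<subseteq> pverts G \<and>
     (\<forall>r t. robber_play G r \<longrightarrow>
        list_all2 (legal_move G) (cop_positions \<sigma> r t) (cop_positions \<sigma> r (Suc t)))"

text \<open>
  In round \<open>t + 1\<close> the cops move to \<open>cop_positions \<sigma> r (t + 1)\<close> while the robber is still at
  \<open>r t\<close>; the first disjunct below is a capture at the end of round \<open>t\<close>, the second one a capture
  by the cops' move in round \<open>t + 1\<close>.
\<close>

definition cops_win :: "'a pair_pre_digraph \<Rightarrow> nat \<Rightarrow> bool" where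
  "cops_win G k \<longleftrightarrow>
     (\<exists>\<sigma>. cop_strategy G k \<sigma> \<and>
       (\<forall>r. robber_play G r \<longrightarrow>
         (\<exists>t. r t \<in> set (cop_positions \<sigma> r t) \<or> r t \<in> set (cop_positions \<sigma> r (Suc t)))))"

definition cop_number :: "'a pair_pre_digraph \<Rightarrow> nat" where
  "cop_number G = (LEAST k. cops_win G k)"

text \<open>The minimum is taken over a nonempty set: a cop on every vertex wins at once.\<close>

lemma cops_win_card:
  assumes "pair_graph G"
  shows "cops_win G (card (pverts G))"
proof -
  interpret pair_graph G by (rule assms)
  obtain xs where xs: "set xs = pverts G" "distinct xs"
    using finite_distinct_list pair_finite_verts by blast
  have "cop_strategy G (card (pverts G)) (\<lambda>_. xs)"
    using xs by (auto simp: cop_strategy_def cop_positions_def legal_move_def list_all2_same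
        distinct_card[symmetric])
  moreover have "r 0 \<in> set (cop_positions (\<lambda>_. xs) r 0)" if "robber_play G r" for r
    using that xs by (simp add: cop_positions_def robber_play_def)
  ultimately show ?thesis unfolding cops_win_def by blast
qed

text \<open>
  Asymptotics for families indexed by an infinite set \<open>I\<close> are taken as \<open>n\<close> tends to infinity
  within \<open>I\<close>.
\<close>

abbreviation at_top_in :: "nat set \<Rightarrow> nat filter" where
  "at_top_in I \<equiv> inf at_top (principal I)"

end

theory Submission
  imports Defs
begin

text \<open>
  Let \<open>G'\<close> have two copies \<open>(v, False)\<close> and \<open>(v, True)\<close> of every vertex \<open>v\<close> of \<open>G\<close>, where copies of
  \<open>u\<close> and \<open>v\<close> of different sides are joined iff a player on \<open>G\<close> may move from \<open>u\<close> to \<open>v\<close>, standing still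
  included. The two sides form a bipartition, the edges between the two copies of a vertex make
  \<open>G'\<close> inherit connectedness from \<open>G\<close>, and the order exactly doubles. So it suffices to prove
  \<open>c(G) \<le> c(G') \<le> 2 c(G)\<close>, and this is what the game is compared for.

  For the first inequality, the robber of \<open>G\<close> imagines that he changes sides in every round. Staying
  at a vertex of \<open>G\<close> then becomes a genuine move of \<open>G'\<close>, so every robber play on \<open>G\<close> is the
  projection of one on \<open>G'\<close>. Cops of \<open>G'\<close> who catch the lifted robber catch the original one
  after projection.

  For the second inequality, each cop of \<open>G\<close> is replaced by two cops standing on the two copies of his
  vertex. When he moves, both follow and exchange sides. The pair covers both copies at every time, so
  catching the projection of the robber of \<open>G'\<close> is catching the robber himself.

  Both arguments are instances of one transfer principle, \<open>cops_win_transfer\<close>: the robber's positions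
  are translated from one graph to the other, and the cops' answers are translated back.
\<close>

section \<open>Transferring strategies between graphs\<close>

lemma legal_moveD: "legal_move G u v \<Longrightarrow> u \<in> pverts G \<and> v \<in> pverts G"
  by (simp add: legal_move_def)

text \<open>
  The cops on \<open>G\<close> look up the answer of a winning strategy on \<open>H\<close> to the translated robber \<open>\<phi>\<close>
  and translate it by \<open>\<psi>\<close>. Both translations may depend on the round, which is what allows players
  to change sides in every round in a bipartite graph. The map \<open>\<psi>\<close> acts on the whole team, so that
  the number of cops may change. The times in \<open>caught\<close> are independent because cops moving in round
  \<open>t + 1\<close> capture a robber who still stands where he moved in round \<open>t\<close>.
\<close>

lemma cops_win_transfer:
  fixes \<phi> :: "nat \<Rightarrow> 'a \<Rightarrow> 'b" and \<psi> :: "nat \<Rightarrow> 'b list \<Rightarrow> 'a list"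
  assumes win: "cops_win H k"
    and start: "\<And>v. v \<in> pverts G \<Longrightarrow> \<phi> 0 v \<in> pverts H"
    and robber: "\<And>t u v. legal_move G u v \<Longrightarrow> legal_move H (\<phi> t u) (\<phi> (Suc t) v)"
    and length: "\<And>cs. length cs = k \<Longrightarrow> length (\<psi> 0 cs) = k'"
    and cops: "\<And>t cs ds. list_all2 (legal_move H) cs ds \<Longrightarrow>
      list_all2 (legal_move G) (\<psi> t cs) (\<psi> (Suc t) ds)"
    and caught: "\<And>s t v cs. v \<in> pverts G \<Longrightarrow> \<phi> s v \<in> set cs \<Longrightarrow> v \<in> set (\<psi> t cs)"
  shows "cops_win G k'"
proof -
  obtain \<sigma> where strat: "cop_strategy H k \<sigma>"
    and wins: "\<And>r. robber_play H r \<Longrightarrow>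
      \<exists>t. r t \<in> set (cop_positions \<sigma> r t) \<or> r t \<in> set (cop_positions \<sigma> r (Suc t))"
    using win unfolding cops_win_def by blast
  define \<sigma>' where
    "\<sigma>' rs = \<psi> (length rs) (\<sigma> (map (\<lambda>t. \<phi> t (rs ! t)) [0..<length rs]))" for rs
  define lift where "lift r = (\<lambda>t. \<phi> t (r t))" for r :: "nat \<Rightarrow> 'a"
  have positions: "cop_positions \<sigma>' r t = \<psi> t (cop_positions \<sigma> (lift r) t)" for r t
  proof -
    have "map (\<lambda>s. \<phi> s (map r [0..<t] ! s)) [0..<t] = map (lift r) [0..<t]"
      by (simp add: lift_def)
    then show ?thesis by (simp add: cop_positions_def \<sigma>'_def del: map_eq_conv)
  qed
  have lift: "robber_play H (lift r)" if "robber_play G r" for r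
    using that start robber by (auto simp: robber_play_def lift_def)
  have initial: "set (\<sigma>' []) \<subseteq> pverts G"
  proof -
    \<comment> \<open>Standing still is a legal move exactly on vertices, so \<open>cops\<close> keeps the team inside \<open>G\<close>.\<close>
    have "list_all2 (legal_move H) (\<sigma> []) (\<sigma> [])"
      using strat by (auto simp: cop_strategy_def legal_move_def list_all2_same)
    then have "list_all2 (legal_move G) (\<psi> 0 (\<sigma> [])) (\<psi> (Suc 0) (\<sigma> []))"
      by (rule cops)
    then show ?thesis
      by (auto simp: \<sigma>'_def list_all2_conv_all_nth in_set_conv_nth legal_move_def)
  qed
  have "cop_strategy G k' \<sigma>'"
    unfolding cop_strategy_def
  proof (intro conjI allI impI initial)
    show "length (\<sigma>' []) = k'"
      using strat length by (simp add: \<sigma>'_def cop_strategy_def)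
    show "list_all2 (legal_move G) (cop_positions \<sigma>' r t) (cop_positions \<sigma>' r (Suc t))"
      if "robber_play G r" for r t
      unfolding positions
      using strat lift[OF that] by (intro cops) (simp add: cop_strategy_def)
  qed
  moreover have "\<exists>t. r t \<in> set (cop_positions \<sigma>' r t) \<or> r t \<in> set (cop_positions \<sigma>' r (Suc t))"
    if play: "robber_play G r" for r
  proof -
    have vert: "r t \<in> pverts G" for t
      using play by (auto simp: robber_play_def dest: legal_moveD)
    obtain t where "lift r t \<in> set (cop_positions \<sigma> (lift r) t)
        \<or> lift r t \<in> set (cop_positions \<sigma> (lift r) (Suc t))"
      using wins[OF lift[OF play]] by blast
    then show ?thesis
      unfolding positions lift_def[of r] using caught[OF vert] by blast
  qed
  ultimately show ?thesis unfolding cops_win_def by blast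
qed

lemma cops_win_cop_number:
  assumes "pair_graph G"
  shows "cops_win G (cop_number G)"
  unfolding cop_number_def using cops_win_card[OF assms] by (rule LeastI)

lemma cop_number_le: "cops_win G k \<Longrightarrow> cop_number G \<le> k"
  unfolding cop_number_def by (rule Least_le)

section \<open>The bipartite double of a graph\<close>

text \<open>
  This is the categorical product of \<open>K\<^sub>2\<close> with the graph obtained from \<open>G\<close> by adding a loop at each
  vertex; the loops are hidden in \<^const>\<open>legal_move\<close>. The parameter \<open>e\<close> names the copies of the
  vertices, so that the vertex type can be chosen freely.
\<close>

definition looped_double :: "('a \<times> bool \<Rightarrow> 'b) \<Rightarrow> 'a pair_pre_digraph \<Rightarrow> 'b pair_pre_digraph" where
  "looped_double e G = \<lparr>pverts = e ` (pverts G \<times> UNIV),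
     parcs = {(e (u, i), e (v, \<not> i)) |u v i. legal_move G u v}\<rparr>"

locale double_graph = pair_graph G for G :: "'a pair_pre_digraph" +
  fixes e :: "'a \<times> bool \<Rightarrow> 'b"
  assumes inj: "inj_on e (pverts G \<times> UNIV)"
begin

abbreviation D :: "'b pair_pre_digraph" where
  "D \<equiv> looped_double e G"

definition proj :: "'b \<Rightarrow> 'a" where
  "proj x = fst (inv_into (pverts G \<times> UNIV) e x)"

lemma proj_copy [simp]: "v \<in> pverts G \<Longrightarrow> proj (e (v, i)) = v"
  using inj by (simp add: proj_def)

lemma copy_eq_iff:
  "u \<in> pverts G \<Longrightarrow> v \<in> pverts G \<Longrightarrow> e (u, i) = e (v, j) \<longleftrightarrow> u = v \<and> i = j"
  using inj by (auto simp: inj_on_def)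

lemma pverts_D: "pverts D = e ` (pverts G \<times> UNIV)"
  by (simp add: looped_double_def)

lemma parcs_D: "parcs D = {(e (u, i), e (v, \<not> i)) |u v i. legal_move G u v}"
  by (simp add: looped_double_def)

lemma legal_move_sym: "legal_move G u v \<Longrightarrow> legal_move G v u"
  using pair_sym_arcs by (auto simp: legal_move_def symmetric_def dest: symD)

lemma pair_graph_D: "pair_graph D"
proof -
  have wf: "u \<in> pverts D \<and> v \<in> pverts D \<and> u \<noteq> v \<and> (v, u) \<in> parcs D"
    if arc: "(u, v) \<in> parcs D" for u v
  proof -
    obtain a b i where ab: "u = e (a, i)" "v = e (b, \<not> i)" "legal_move G a b"
      using arc by (auto simp: parcs_D)
    have "(e (b, \<not> i), e (a, \<not> \<not> i)) \<in> parcs D"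
      unfolding parcs_D using legal_move_sym[OF ab(3)] by blast
    then show ?thesis
      using ab legal_moveD[OF ab(3)] by (auto simp: pverts_D copy_eq_iff)
  qed
  have fin: "finite (pverts D)"
    by (simp add: pverts_D pair_finite_verts)
  moreover have "finite (parcs D)"
  proof (rule finite_subset)
    show "parcs D \<subseteq> pverts D \<times> pverts D" using wf by auto
  qed (simp add: fin)
  moreover have "symmetric (with_proj D)"
    using wf by (auto simp: symmetric_def intro: symI)
  ultimately show ?thesis
    using wf by unfold_locales auto
qed

lemma card_pverts_D: "card (pverts D) = 2 * card (pverts G)"
  using inj by (simp add: pverts_D card_image card_cartesian_product)

lemma bipartite_D: "bipartite D"
  unfolding bipartite_def
proof (intro exI conjI)
  let ?side = "\<lambda>i. (\<lambda>v. e (v, i)) ` pverts G"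
  show "?side False \<union> ?side True = pverts D"
  proof (intro equalityI subsetI)
    fix x assume "x \<in> pverts D"
    then obtain v i where "x = e (v, i)" "v \<in> pverts G" by (auto simp: pverts_D)
    then show "x \<in> ?side False \<union> ?side True" by (cases i) auto
  qed (auto simp: pverts_D)
  show "?side False \<inter> ?side True = {}"
    by (auto simp: copy_eq_iff)
  show "parcs D \<subseteq> ?side False \<times> ?side True \<union> ?side True \<times> ?side False"
  proof
    fix x assume "x \<in> parcs D"
    then obtain u v i where "x = (e (u, i), e (v, \<not> i))" "legal_move G u v"
      by (auto simp: parcs_D)
    then show "x \<in> ?side False \<times> ?side True \<union> ?side True \<times> ?side False"
      by (cases i) (auto dest: legal_moveD)
  qed
qed

text \<open>
  A walk in \<open>G\<close> lifts step by step. The side on which the lifted walk ends is corrected by a last step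
  between the two copies of the end vertex.
\<close>

lemma connected_D:
  assumes "Digraph_Component.connected (with_proj G)"
  shows "Digraph_Component.connected (with_proj D)"
proof -
  interpret D: pair_graph D by (rule pair_graph_D)
  have strong: "strongly_connected (with_proj G)"
    using pair_sym_arcs assms by (rule symmetric_connected_imp_strongly_connected)
  have arc: "(e (u, i), e (v, \<not> i)) \<in> parcs D" if "legal_move G u v" for u v i
    using that by (auto simp: parcs_D)
  have lift: "\<exists>j. e (u, i) \<rightarrow>\<^sup>*\<^bsub>with_proj D\<^esub> e (v, j)"
    if "u \<rightarrow>\<^sup>*\<^bsub>with_proj G\<^esub> v" for u v i
    using that
  proof (induction rule: reachable_induct)
    case base
    then have "e (u, i) \<in> pverts D" by (simp add: pverts_D)
    then show ?case by auto
  next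
    case (step x y)
    then obtain j where "e (u, i) \<rightarrow>\<^sup>*\<^bsub>with_proj D\<^esub> e (x, j)" by blast
    moreover have "legal_move G x y"
      using step.hyps by (auto simp: legal_move_def dest: in_arcsD1 in_arcsD2)
    ultimately show ?case
      using D.reachable_adj_trans arc by blast
  qed
  have reach: "e (u, i) \<rightarrow>\<^sup>*\<^bsub>with_proj D\<^esub> e (v, k)"
    if "u \<in> pverts G" "v \<in> pverts G" for u v i k
  proof -
    obtain j where j: "e (u, i) \<rightarrow>\<^sup>*\<^bsub>with_proj D\<^esub> e (v, j)"
      using lift strong \<open>u \<in> pverts G\<close> \<open>v \<in> pverts G\<close> by (fastforce simp: strongly_connected_def)
    have "(e (v, j), e (v, \<not> j)) \<in> parcs D"
      using that by (intro arc) (simp add: legal_move_def)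
    then have "e (u, i) \<rightarrow>\<^sup>*\<^bsub>with_proj D\<^esub> e (v, \<not> j)"
      using j by (rule D.reachable_adj_trans[rotated])
    then show ?thesis using j by (cases "k = j") auto
  qed
  have "strongly_connected (with_proj D)"
    using strong reach by (auto simp: strongly_connected_def pverts_D)
  then show ?thesis
    using D.reachable_mk_symmetric_eq[OF D.pair_sym_arcs]
    by (simp add: Digraph_Component.connected_def strongly_connected_def)
qed

section \<open>Comparing the cop numbers\<close>

lemma legal_move_proj:
  "legal_move D x y \<Longrightarrow> legal_move G (proj x) (proj y)"
  by (auto simp: legal_move_def[of D] pverts_D parcs_D dest: legal_moveD)
    (auto simp: legal_move_def)

lemma legal_move_copy:
  "legal_move G u v \<Longrightarrow> legal_move D (e (u, i)) (e (v, \<not> i))"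
  by (auto simp: legal_move_def[of D] pverts_D parcs_D dest: legal_moveD)

text \<open>
  The lifted robber never stands still, since adjacent vertices of the double lie on different sides;
  his side is the parity of the time.
\<close>

lemma cop_number_le_D: "cop_number G \<le> cop_number D"
proof (rule cop_number_le, rule cops_win_transfer)
  show "cops_win D (cop_number D)"
    by (rule cops_win_cop_number[OF pair_graph_D])
  show "e (v, even (0::nat)) \<in> pverts D" if "v \<in> pverts G" for v
    using that by (simp add: pverts_D)
  show "legal_move D (e (u, even t)) (e (v, even (Suc t)))" if "legal_move G u v" for t u v
    using legal_move_copy[OF that] by simp
  show "length (map proj cs) = cop_number D" if "length cs = cop_number D" for cs
    using that by simp
  show "list_all2 (legal_move G) (map proj cs) (map proj ds)"
    if "list_all2 (legal_move D) cs ds" for cs ds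
    using that by (auto simp: list_all2_map1 list_all2_map2 elim!: list_all2_mono legal_move_proj)
  show "v \<in> set (map proj cs)" if "v \<in> pverts G" "e (v, even s) \<in> set cs" for v s cs
    using that by (metis image_eqI list.set_map proj_copy)
qed

text \<open>
  A pair always covers both copies of a vertex, so the side the robber is on cannot save him. Its two
  cops must exchange sides in every round, since one cannot follow an edge of \<open>G\<close> within a side.
\<close>

lemma cop_number_D_le: "cop_number D \<le> 2 * cop_number G"
proof (rule cop_number_le, rule cops_win_transfer)
  let ?team = "\<lambda>t cs. map (\<lambda>c. e (c, even t)) cs @ map (\<lambda>c. e (c, odd t)) cs"
  show "cops_win G (cop_number G)"
    by (rule cops_win_cop_number) unfold_locales
  show "proj x \<in> pverts G" if "x \<in> pverts D" for x
    using that by (auto simp: pverts_D)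
  show "legal_move G (proj x) (proj y)" if "legal_move D x y" for x y
    using that by (rule legal_move_proj)
  show "length (?team (0::nat) cs) = 2 * cop_number G" if "length cs = cop_number G" for cs
    using that by simp
  show "list_all2 (legal_move D) (?team t cs) (?team (Suc t) ds)"
    if "list_all2 (legal_move G) cs ds" for t cs ds
  proof -
    have "list_all2 (legal_move D) (map (\<lambda>c. e (c, i)) cs) (map (\<lambda>c. e (c, \<not> i)) ds)" for i
      using that by (auto simp: list_all2_map1 list_all2_map2 elim!: list_all2_mono legal_move_copy)
    from this[of "even t"] this[of "odd t"] show ?thesis
      by (auto intro: list_all2_appendI)
  qed
  show "x \<in> set (?team t cs)" if x: "x \<in> pverts D" "proj x \<in> set cs" for t x cs
  proof -
    obtain a i where "x = e (a, i)" "a \<in> set cs"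
      using x by (auto simp: pverts_D)
    then show ?thesis by (cases "even t = i") auto
  qed
qed

end

section \<open>Families of graphs\<close>

text \<open>Finiteness allows the copies to be named by natural numbers, for any type of vertices.\<close>

lemma ex_bipartite_double:
  fixes G :: "'a pair_pre_digraph"
  assumes "pair_graph G" and "Digraph_Component.connected G"
  shows "\<exists>H :: nat pair_pre_digraph.
    pair_graph H \<and> Digraph_Component.connected H \<and> bipartite H \<and>
    cop_number G \<le> cop_number H \<and> cop_number H \<le> 2 * cop_number G \<and>
    card (pverts H) = 2 * card (pverts G)"
proof -
  interpret pair_graph G by (rule assms)
  obtain e :: "'a \<times> bool \<Rightarrow> nat" where "inj_on e (pverts G \<times> UNIV)"
    using finite_imp_inj_to_nat_seg[of "pverts G \<times> (UNIV :: bool set)"] pair_finite_verts by auto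
  then interpret double_graph G e by unfold_locales
  show ?thesis
    using pair_graph_D connected_D[OF assms(2)] bipartite_D cop_number_le_D cop_number_D_le
      card_pverts_D by blast
qed

lemma bigtheta_of_le_double:
  fixes f g :: "nat \<Rightarrow> nat"
  assumes "\<And>n. n \<in> I \<Longrightarrow> f n \<le> g n \<and> g n \<le> 2 * f n"
  shows "(\<lambda>n. real (g n)) \<in> \<Theta>[at_top_in I](\<lambda>n. real (f n))"
proof
  have ev: "eventually (\<lambda>n. real (f n) \<le> real (g n) \<and> real (g n) \<le> 2 * real (f n)) (at_top_in I)"
    unfolding eventually_inf_principal
  proof (intro always_eventually allI impI)
    fix n assume "n \<in> I"
    from assms[OF this] show "real (f n) \<le> real (g n) \<and> real (g n) \<le> 2 * real (f n)"
      by linarith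
  qed
  show "(\<lambda>n. real (g n)) \<in> O[at_top_in I](\<lambda>n. real (f n))"
    by (rule landau_o.bigI[of 2]) (use ev in \<open>auto elim: eventually_mono\<close>)
  show "(\<lambda>n. real (g n)) \<in> \<Omega>[at_top_in I](\<lambda>n. real (f n))"
    by (rule landau_omega.bigI[of 1]) (use ev in \<open>auto elim: eventually_mono\<close>)
qed

theorem corollary26:
  fixes I :: "nat set" and \<epsilon> :: real
  assumes "infinite I" and "0 \<notin> I"
    and "0 \<le> \<epsilon>" and "\<epsilon> < 1"
    and "\<exists>G :: nat \<Rightarrow> 'a pair_pre_digraph.
      (\<forall>n\<in>I. pair_graph (G n) \<and> Digraph_Component.connected (G n)) \<and>
      (\<lambda>n. real (cop_number (G n))) \<in> \<Theta>[at_top_in I](\<lambda>n. real n powr (1 - \<epsilon>)) \<and>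
      (\<lambda>n. real (card (pverts (G n)))) \<in> \<Theta>[at_top_in I](\<lambda>n. real n)"
  shows "\<exists>G' :: nat \<Rightarrow> nat pair_pre_digraph.
      (\<forall>n\<in>I. pair_graph (G' n) \<and> Digraph_Component.connected (G' n) \<and> bipartite (G' n)) \<and>
      (\<lambda>n. real (cop_number (G' n))) \<in> \<Theta>[at_top_in I](\<lambda>n. real n powr (1 - \<epsilon>)) \<and>
      (\<lambda>n. real (card (pverts (G' n)))) \<in> \<Theta>[at_top_in I](\<lambda>n. real n)"
proof -
  obtain G :: "nat \<Rightarrow> 'a pair_pre_digraph" where
    graph: "\<And>n. n \<in> I \<Longrightarrow> pair_graph (G n) \<and> Digraph_Component.connected (G n)"
    and cop: "(\<lambda>n. real (cop_number (G n))) \<in> \<Theta>[at_top_in I](\<lambda>n. real n powr (1 - \<epsilon>))"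
    and order: "(\<lambda>n. real (card (pverts (G n)))) \<in> \<Theta>[at_top_in I](\<lambda>n. real n)"
    using assms(5) by blast
  have "\<forall>n\<in>I. \<exists>H :: nat pair_pre_digraph.
      pair_graph H \<and> Digraph_Component.connected H \<and> bipartite H \<and>
      cop_number (G n) \<le> cop_number H \<and> cop_number H \<le> 2 * cop_number (G n) \<and>
      card (pverts H) = 2 * card (pverts (G n))"
    using graph ex_bipartite_double by blast
  then obtain G' :: "nat \<Rightarrow> nat pair_pre_digraph" where
    G': "\<forall>n\<in>I. pair_graph (G' n) \<and> Digraph_Component.connected (G' n) \<and> bipartite (G' n) \<and>
      cop_number (G n) \<le> cop_number (G' n) \<and> cop_number (G' n) \<le> 2 * cop_number (G n) \<and>
      card (pverts (G' n)) = 2 * card (pverts (G n))"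
    unfolding bchoice_iff by blast
  have "(\<lambda>n. real (cop_number (G' n))) \<in> \<Theta>[at_top_in I](\<lambda>n. real n powr (1 - \<epsilon>))"
    using G' by (intro landau_theta.trans[OF bigtheta_of_le_double cop]) auto
  moreover have "(\<lambda>n. real (card (pverts (G' n)))) \<in> \<Theta>[at_top_in I](\<lambda>n. real n)"
    using G' by (intro landau_theta.trans[OF bigtheta_of_le_double order]) auto
  ultimately show ?thesis
    using G' by blast
qed

end
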